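(* Let $(X,d)$ be a compact metric space, let $f_n:X\to X$ be continuous for every $n\ge0$, let $A=(a_{ij})_{N\times N}$ be a transition matrix, and let $\{V_{i,n}\}_{n=0}^\infty$, $1\le i\le N$, be sequences of nonempty closed subsets of $X$. For $\alpha=(a_0,a_1,\dots)\in\Sigma_N^+(A)$ put $V_\alpha^{m,n}:=\bigcap_{k=0}^{m}f_n^{-k}(V_{a_k,n+k})$. Assume that: - $V_\alpha^{m,n}\neq\emptyset$ for all $m,n\ge0$ and all $\alpha\in\Sigma_N^+(A)$; - for every $\alpha\in\Sigma_N^+(A)$, the diameter $d(V_\alpha^{m,n})$ converges to $0$ as $m\to\infty$ uniformly with respect to $n\ge0$. Then for every $n\ge0$ there exists a nonempty compact subset $\mathcal C_n\subset\bigcup_{i=1}^N\langle V_{i,n}\rangle$ of $\mathcal K(X)$ with $\bar f_n(\mathcal C_n)=\mathcal C_{n+1}$ such that $(\Sigma_N^+(A),\sigma_A)$ is topologically equi-semiconjugate to the invariant subsystem of the induced set-valued system $A_{n+1}=\bar f_n(A_n)$ on $\{\mathcal C_n\}_{n=0}^\infty$. Consequently, $h(\bar f_{0,\infty},\mathcal C_0)\le\log\rho(A)$.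
   Context: For a sequence of maps $g_n$ of a space $Z$ into itself, $g_i^n:=g_{i+n-1}\circ\cdots\circ g_i$ for $n\ge1$, $g_i^0$ is the identity, and $g_i^{-n}:=(g_i^n)^{-1}$ (preimage). $d(B)$ is the diameter of $B\subset X$. $\mathcal K(X)$ is the set of all nonempty compact subsets of $X$ with the Hausdorff metric $\mathcal H_d(B,C):=\max\{\sup_{b\in B}d(b,C),\sup_{c\in C}d(c,B)\}$ (a compact metric space). For nonempty $K\subset X$, $\langle K\rangle:=\{B\in\mathcal K(X):B\subset K\}$; $\bar f_n:\mathcal K(X)\to\mathcal K(X)$ is $\bar f_n(B):=f_n(B)$; $\bar f_{0,\infty}:=\{\bar f_n\}_{n=0}^\infty$. In $\bar f_n(\mathcal C_n)$ the map $\bar f_n$ is applied elementwise: $\bar f_n(\mathcal C_n)=\{\bar f_n(B):B\in\mathcal C_n\}$. A transition matrix is a matrix $A=(a_{ij})_{N\times N}$, $N\ge2$, with $a_{ij}\in\{0,1\}$, $\sum_{j=1}^N a_{ij}\ge1$ for all $i$ and $\sum_{i=1}^N a_{ij}\ge1$ for all $j$. $\Sigma_N^+(A):=\{s=(s_0,s_1,\dots):1\le s_j\le N,\ a_{s_js_{j+1}}=1,\ j\ge0\}$, with metric $\hat\rho(\alpha,\beta):=\sum_{i=0}^\infty \hat d(a_i,b_i)/2^i$ for $\alpha=(a_0,a_1,\dots)$, $\beta=(b_0,b_1,\dots)$, where $\hat d(a,b)=0$ if $a=b$ and $1$ otherwise. $\sigma_A:\Sigma_N^+(A)\to\Sigma_N^+(A)$,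 $\sigma_A((s_0,s_1,s_2,\dots)):=(s_1,s_2,\dots)$. $\rho(A):=\lim_{n\to\infty}\|A^n\|^{1/n}$, where $\|B\|$ denotes the sum of all entries of $B$. For subsets $\mathcal C_n\subset\mathcal K(X)$ with $\bar f_n(\mathcal C_n)\subset\mathcal C_{n+1}$ for all $n\ge0$, the set-valued system restricted to $\{\mathcal C_n\}$ is called its invariant subsystem on $\{\mathcal C_n\}_{n=0}^\infty$. $(\Sigma_N^+(A),\sigma_A)$ is topologically equi-semiconjugate to it if there are surjective maps $h_n:\Sigma_N^+(A)\to\mathcal C_n$, $n\ge0$, such that $h_{n+1}\circ\sigma_A=\bar f_n\circ h_n$ for all $n\ge0$ and $\{h_n\}$ is equi-continuous: for every $\epsilon>0$ there is $\delta>0$ such that $\mathcal H_d(h_n(\alpha),h_n(\beta))<\epsilon$ for all $n\ge0$ and all $\alpha,\beta$ with $\hat\rho(\alpha,\beta)<\delta$. Topological entropy: for a compact metric space $Z$, maps $g_n:Z\to Z$ and nonempty $Y\subset Z$, $h(g_{0,\infty},Y):=\sup_{\mathcal A}\limsup_{n\to\infty}\frac1n\log\mathcal N(\mathcal A_0^n|_Y)$, the supremum over open covers $\mathcal A$ of $Z$, where $\mathcal A_0^n:=\{\bigcap_{j=0}^{n-1}g_0^{-j}(A_j):A_j\in\mathcal A\}$, $\mathcal B|_Y:=\{B\cap Y:B\in\mathcal B\}$, and $\mathcal N(\cdot)$ is the minimal cardinality of a subcover. *)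

theory Defs
  imports "HOL-Analysis.Analysis" "Jordan_Normal_Form.Matrix"
begin

text \<open>\<open>iter g i n\<close> is the composition \<open>g (i + n - 1) \<circ> \<dots> \<circ> g i\<close>, with index \<open>i\<close> the starting time.\<close>

primrec iter :: "(nat \<Rightarrow> 'z \<Rightarrow> 'z) \<Rightarrow> nat \<Rightarrow> nat \<Rightarrow> 'z \<Rightarrow> 'z" where
  "iter g i 0 = id"
| "iter g i (Suc n) = g (i + n) \<circ> iter g i n"

definition hyperspace :: "'a::metric_space set \<Rightarrow> 'a set set" where
  "hyperspace X = {B. B \<noteq> {} \<and> compact B \<and> B \<subseteq> X}"

text \<open>The value \<open>0\<close> outside nonempty bounded sets only makes the function total: the locale
  \<^locale>\<open>Metric_space\<close> asks for nonnegativity on the whole type.\<close>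

definition hausdorff_dist :: "'a::metric_space set \<Rightarrow> 'a set \<Rightarrow> real" where
  "hausdorff_dist B C =
     (if B \<noteq> {} \<and> C \<noteq> {} \<and> bounded B \<and> bounded C
      then max (SUP b\<in>B. infdist b C) (SUP c\<in>C. infdist c B) else 0)"

lemma bdd_above_infdist:
  fixes B C :: "'a::metric_space set"
  assumes "bounded B" "C \<noteq> {}"
  shows "bdd_above ((\<lambda>b. infdist b C) ` B)"
proof -
  obtain c where c: "c \<in> C" using assms by blast
  obtain e where "\<forall>b\<in>B. dist c b \<le> e" using assms(1) bounded_any_center by blast
  then have "infdist b C \<le> e" if "b \<in> B" for b
    using infdist_le[OF c, of b] that by (metis dist_commute order_trans)
  then show ?thesis by (rule bdd_aboveI2)
qed

lemma hausdorff_dist_le_iff: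
  fixes B C :: "'a::metric_space set"
  assumes "B \<noteq> {}" "C \<noteq> {}" "bounded B" "bounded C"
  shows "hausdorff_dist B C \<le> e \<longleftrightarrow> (\<forall>b\<in>B. infdist b C \<le> e) \<and> (\<forall>c\<in>C. infdist c B \<le> e)"
  using assms by (simp add: hausdorff_dist_def cSUP_le_iff bdd_above_infdist)

lemma hausdorff_dist_commute: "hausdorff_dist B C = hausdorff_dist C B"
  by (auto simp: hausdorff_dist_def max.commute)

lemma hausdorff_dist_nonneg: "0 \<le> hausdorff_dist B C"
proof (cases "B \<noteq> {} \<and> C \<noteq> {} \<and> bounded B \<and> bounded C")
  case True
  then show ?thesis
    using hausdorff_dist_le_iff[of B C "hausdorff_dist B C"] infdist_nonneg
    by (metis all_not_in_conv order.refl order_trans)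
next
  case False
  then show ?thesis by (auto simp: hausdorff_dist_def)
qed

lemma infdist_le_hausdorff_add:
  fixes A B C :: "'a::metric_space set"
  assumes ne: "A \<noteq> {}" "B \<noteq> {}" "C \<noteq> {}" and bd: "bounded A" "bounded B" "bounded C"
    and "a \<in> A"
  shows "infdist a C \<le> hausdorff_dist A B + hausdorff_dist B C"
proof -
  have "infdist a C - hausdorff_dist B C \<le> dist a b" if "b \<in> B" for b
    using infdist_triangle[of a C b] hausdorff_dist_le_iff[of B C "hausdorff_dist B C"] ne bd that
    by fastforce
  then have "infdist a C - hausdorff_dist B C \<le> infdist a B"
    using ne by (auto simp: infdist_notempty intro!: cINF_greatest)
  moreover have "infdist a B \<le> hausdorff_dist A B"
    using hausdorff_dist_le_iff[of A B "hausdorff_dist A B"] ne bd \<open>a \<in> A\<close> by auto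
  ultimately show ?thesis by linarith
qed

lemma Metric_space_hyperspace: "Metric_space (hyperspace X) hausdorff_dist"
proof
  fix A B C :: "'a set"
  assume A: "A \<in> hyperspace X" and B: "B \<in> hyperspace X"
  then have AB: "A \<noteq> {}" "B \<noteq> {}" "compact A" "compact B" by (auto simp: hyperspace_def)
  show "hausdorff_dist A B = 0 \<longleftrightarrow> A = B"
  proof
    assume "hausdorff_dist A B = 0"
    then have "\<forall>a\<in>A. infdist a B = 0" "\<forall>b\<in>B. infdist b A = 0"
      using hausdorff_dist_le_iff[of A B 0] AB compact_imp_bounded infdist_nonneg
      by (metis order.antisym order.refl)+
    then show "A = B"
      using AB compact_imp_closed in_closed_iff_infdist_zero by blast
  next
    assume "A = B"
    then show "hausdorff_dist A B = 0"
      using hausdorff_dist_le_iff[of A B 0] AB compact_imp_bounded hausdorff_dist_nonneg[of A B]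
      by (metis infdist_zero order.antisym order.refl)
  qed
  assume "C \<in> hyperspace X"
  then have C: "C \<noteq> {}" "compact C" by (auto simp: hyperspace_def)
  show "hausdorff_dist A C \<le> hausdorff_dist A B + hausdorff_dist B C"
    using infdist_le_hausdorff_add[of A B C] infdist_le_hausdorff_add[of C B A] AB C
    by (auto simp: hausdorff_dist_le_iff compact_imp_bounded hausdorff_dist_commute add.commute)
qed (simp_all add: hausdorff_dist_nonneg hausdorff_dist_commute)

definition hyperspace_topology :: "'a::metric_space set \<Rightarrow> 'a set topology" where
  "hyperspace_topology X = Metric_space.mtopology (hyperspace X) hausdorff_dist"

definition hyper_sub :: "'a::metric_space set \<Rightarrow> 'a set \<Rightarrow> 'a set set" where
  "hyper_sub X K = {B \<in> hyperspace X. B \<subseteq> K}"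

definition induced_map :: "(nat \<Rightarrow> 'a \<Rightarrow> 'a) \<Rightarrow> nat \<Rightarrow> 'a set \<Rightarrow> 'a set" where
  "induced_map f n B = f n ` B"

text \<open>Symbols are the matrix indices \<open>0, \<dots>, N - 1\<close>.\<close>

definition transition_matrix :: "nat \<Rightarrow> real mat \<Rightarrow> bool" where
  "transition_matrix N A \<longleftrightarrow> N \<ge> 2 \<and> A \<in> carrier_mat N N \<and>
     (\<forall>i<N. \<forall>j<N. A $$ (i, j) \<in> {0, 1}) \<and>
     (\<forall>i<N. (\<Sum>j<N. A $$ (i, j)) \<ge> 1) \<and>
     (\<forall>j<N. (\<Sum>i<N. A $$ (i, j)) \<ge> 1)"

definition subshift :: "nat \<Rightarrow> real mat \<Rightarrow> (nat \<Rightarrow> nat) set" where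
  "subshift N A = {s. \<forall>j. s j < N \<and> A $$ (s j, s (Suc j)) = 1}"

definition shift :: "(nat \<Rightarrow> 'b) \<Rightarrow> nat \<Rightarrow> 'b" where
  "shift s = (\<lambda>j. s (Suc j))"

definition symbol_dist :: "(nat \<Rightarrow> 'b) \<Rightarrow> (nat \<Rightarrow> 'b) \<Rightarrow> real" where
  "symbol_dist a b = (\<Sum>i. (if a i = b i then 0 else 1) / 2 ^ i)"

definition entry_sum :: "real mat \<Rightarrow> real" where
  "entry_sum B = (\<Sum>i<dim_row B. \<Sum>j<dim_col B. B $$ (i, j))"

definition matrix_rho :: "real mat \<Rightarrow> real" where
  "matrix_rho A = lim (\<lambda>n. root n (entry_sum (A ^\<^sub>m n)))"

definition equi_semiconjugate ::
  "'s set \<Rightarrow> ('s \<Rightarrow> 's \<Rightarrow> real) \<Rightarrow> ('s \<Rightarrow> 's) \<Rightarrow>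
   (nat \<Rightarrow> 'y set) \<Rightarrow> ('y \<Rightarrow> 'y \<Rightarrow> real) \<Rightarrow> (nat \<Rightarrow> 'y \<Rightarrow> 'y) \<Rightarrow> bool" where
  "equi_semiconjugate S dS T Y dY g \<longleftrightarrow>
     (\<exists>h :: nat \<Rightarrow> 's \<Rightarrow> 'y.
        (\<forall>n. h n ` S = Y n) \<and>
        (\<forall>n. \<forall>s\<in>S. h (Suc n) (T s) = g n (h n s)) \<and>
        (\<forall>\<epsilon>>0. \<exists>\<delta>>0. \<forall>n. \<forall>a\<in>S. \<forall>b\<in>S. dS a b < \<delta> \<longrightarrow> dY (h n a) (h n b) < \<epsilon>))"

text \<open>\<open>refined_cover Z g \<A> n\<close> consists of the sets
  \<open>U\<^sub>0 \<inter> (iter g 0 1)\<^sup>-\<^sup>1 U\<^sub>1 \<inter> \<dots> \<inter> (iter g 0 (n - 1))\<^sup>-\<^sup>1 U\<^bsub>n-1\<^esub>\<close> with all \<open>U\<^sub>j \<in> \<A>\<close>.\<close>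

definition refined_cover ::
  "'z topology \<Rightarrow> (nat \<Rightarrow> 'z \<Rightarrow> 'z) \<Rightarrow> 'z set set \<Rightarrow> nat \<Rightarrow> 'z set set" where
  "refined_cover Z g \<A> n =
     {{z \<in> topspace Z. \<forall>j<n. iter g 0 j z \<in> U j} |U. \<forall>j<n. U j \<in> \<A>}"

definition restrict_cover :: "'z set set \<Rightarrow> 'z set \<Rightarrow> 'z set set" where
  "restrict_cover \<B> Y = (\<lambda>B. B \<inter> Y) ` \<B>"

text \<open>Minimal cardinality of a finite subfamily with the same union; on a compact space every open
  cover has a finite subcover.\<close>

definition min_subcover :: "'z set set \<Rightarrow> nat" where
  "min_subcover \<B> = (LEAST k. \<exists>\<F>\<subseteq>\<B>. finite \<F> \<and> \<Union>\<F> = \<Union>\<B> \<and> card \<F> = k)"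

definition top_entropy :: "'z topology \<Rightarrow> (nat \<Rightarrow> 'z \<Rightarrow> 'z) \<Rightarrow> 'z set \<Rightarrow> ereal" where
  "top_entropy Z g Y =
     (SUP \<A>\<in>{\<A>. (\<forall>U\<in>\<A>. openin Z U) \<and> \<Union>\<A> = topspace Z}.
        limsup (\<lambda>n. ereal (1 / real n *
          ln (real (min_subcover (restrict_cover (refined_cover Z g \<A> n) Y))))))"

definition itinerary_set ::
  "'a set \<Rightarrow> (nat \<Rightarrow> 'a \<Rightarrow> 'a) \<Rightarrow> (nat \<Rightarrow> nat \<Rightarrow> 'a set) \<Rightarrow> (nat \<Rightarrow> nat) \<Rightarrow> nat \<Rightarrow> nat \<Rightarrow> 'a set" where
  "itinerary_set X f V a m n = (\<Inter>k\<le>m. {x \<in> X. iter f n k x \<in> V (a k) (n + k)})"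

end

theory Submission
  imports Defs
begin

text \<open>
  The set \<open>\<Inter>\<^sub>m V\<^bsub>\<alpha>\<^esub>\<^bsup>m,n\<^esup>\<close> is a single point \<open>x\<^sub>n(\<alpha>)\<close>; take \<open>h\<^sub>n(\<alpha>) = {x\<^sub>n(\<alpha>)}\<close> and
  \<open>\<C>\<^sub>n = h\<^sub>n(\<Sigma>(A))\<close>. Uniqueness of the point gives
  \<open>f\<^sub>n(x\<^sub>n(\<alpha>)) = x\<^bsub>n+1\<^esub>(\<sigma>\<alpha>)\<close>. Compactness of \<open>\<Sigma>(A)\<close> upgrades the shrinking of the diameters,
  which is uniform in \<open>n\<close> for each fixed \<open>\<alpha>\<close>, to a bound depending only on the number of common
  initial symbols.
  Since singletons form an isometric copy of \<open>X\<close> in the hyperspace, an open cover of the hyperspace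
  has a Lebesgue number \<open>\<epsilon>\<close> along them. If \<open>M\<close> common symbols force distance below \<open>\<epsilon>\<close>, each
  admissible word of length \<open>n + M + 1\<close> determines one element of the \<open>n\<close>-th refined cover containing
  all \<open>h\<^sub>0(\<alpha>)\<close> with that initial word. There are at most \<open>\<parallel>A\<^bsup>n+M\<^esup>\<parallel>\<close> such words, and the
  growth rate of this norm is \<open>\<rho>(A)\<close> by Fekete's lemma.
\<close>

section \<open>The growth rate of powers of a transition matrix\<close>

text \<open>Division with remainder: if \<open>a k / k\<close> is close to the infimum and n = qk +
  r with r < k, subadditivity bounds \<open>a n\<close> by q times \<open>a k\<close> plus one of
  finitely many remainder terms, whose contribution vanishes after division by n.\<close>

lemma fekete:
  fixes a :: "nat \<Rightarrow> real"
  assumes subadd: "\<And>m n. a (m + n) \<le> a m + a n"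
    and bdd: "bdd_below ((\<lambda>n. a n / real n) ` {1..})"
  shows "(\<lambda>n. a n / real n) \<longlonglongrightarrow> (INF n\<in>{1..}. a n / real n)"
proof (rule order_tendstoI)
  let ?L = "INF n\<in>{1..}. a n / real n"
  fix l assume "l < ?L"
  then have "l < a n / real n" if "n \<ge> 1" for n
    using cINF_lower[OF bdd, of n] that by auto
  then show "\<forall>\<^sub>F n in sequentially. l < a n / real n"
    by (intro eventually_sequentiallyI)
next
  let ?L = "INF n\<in>{1..}. a n / real n"
  fix u assume "?L < u"
  then obtain k where k: "k \<ge> 1" "a k / real k < u"
    using cINF_less_iff[OF _ bdd, of u] by auto
  have mult: "a (q * k + r) \<le> real q * a k + a r" for q r
  proof (induction q)
    case (Suc q)
    then show ?case
      using subadd[of k "q * k + r"] by (simp add: algebra_simps)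
  qed simp
  \<comment> \<open>\<open>B\<close> is the largest excess of \<open>a r\<close> over the line of
    slope \<open>a k / k\<close> among the remainders r < k; it then bounds the excess of
    \<open>a n\<close> for all n \<ge> 1.\<close>
  define B where "B = (MAX r\<in>{..<k}. a r - real r * (a k / real k))"
  have bound: "a n / real n \<le> a k / real k + B / real n" if "n \<ge> 1" for n
  proof -
    have "a n \<le> real (n div k) * a k + a (n mod k)"
      using mult[of "n div k" "n mod k"] by simp
    moreover have "a (n mod k) - real (n mod k) * (a k / real k) \<le> B"
      unfolding B_def using k by (intro Max_ge) auto
    moreover
    have "real n = real (n div k) * real k + real (n mod k)"
      by (metis div_mult_mod_eq of_nat_add of_nat_mult)
    then have "real n * (a k / real k) = real (n div k) * a k + real (n mod k) * (a k / real k)"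
      using k by (simp add: add_divide_distrib distrib_right)
    ultimately have "a n \<le> real n * (a k / real k) + B"
      by linarith
    then show ?thesis
      using that by (simp add: field_simps)
  qed
  have "(\<lambda>n. a k / real k + B / real n) \<longlonglongrightarrow> a k / real k + 0"
    by (intro tendsto_intros lim_const_over_n)
  then have "\<forall>\<^sub>F n in sequentially. a k / real k + B / real n < u"
    using k by (intro order_tendstoD) auto
  then show "\<forall>\<^sub>F n in sequentially. a n / real n < u"
    using eventually_ge_at_top[of 1] by eventually_elim (use bound in fastforce)
qed

section \<open>Sums of entries of matrix powers\<close>

lemma pow_mat_add:
  fixes A :: "'a::semiring_1 mat"
  assumes "A \<in> carrier_mat n n"
  shows "A ^\<^sub>m (k + l) = A ^\<^sub>m k * A ^\<^sub>m l"
proof (induction l)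
  case 0
  then show ?case using assms by (simp add: right_mult_one_mat[OF pow_carrier_mat])
next
  case (Suc l)
  then show ?case
    using assms by (simp add: assoc_mult_mat[OF pow_carrier_mat pow_carrier_mat])
qed

text \<open>Summing the product over its column index first leaves row sums of \<open>C\<close> as
  factors; as entries are nonnegative, each is at most the sum of all entries of
  \<open>C\<close>.\<close>

lemma entry_sum_mult_le:
  assumes B: "B \<in> carrier_mat n n" and C: "C \<in> carrier_mat n n"
    and B0: "\<And>i j. i < n \<Longrightarrow> j < n \<Longrightarrow> B $$ (i, j) \<ge> 0"
    and C0: "\<And>i j. i < n \<Longrightarrow> j < n \<Longrightarrow> C $$ (i, j) \<ge> 0"
  shows "entry_sum (B * C) \<le> entry_sum B * entry_sum C"
proof -
  have "entry_sum (B * C) = (\<Sum>i<n. \<Sum>j<n. \<Sum>k<n. B $$ (i, k) * C $$ (k, j))"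
    using B C by (simp add: entry_sum_def scalar_prod_def atLeast0LessThan)
  also have "\<dots> = (\<Sum>i<n. \<Sum>k<n. B $$ (i, k) * (\<Sum>j<n. C $$ (k, j)))"
    by (rule sum.cong[OF refl], subst sum.swap) (simp add: sum_distrib_left)
  also have "\<dots> \<le> (\<Sum>i<n. \<Sum>k<n. B $$ (i, k) * entry_sum C)"
  proof (intro sum_mono mult_left_mono)
    fix k assume "k \<in> {..<n}"
    then show "(\<Sum>j<n. C $$ (k, j)) \<le> entry_sum C"
      using C C0 member_le_sum[of k "{..<n}" "\<lambda>k. \<Sum>j<n. C $$ (k, j)"]
      by (force simp: entry_sum_def intro: sum_nonneg)
  qed (use B0 in auto)
  also have "\<dots> = entry_sum B * entry_sum C"
    using B by (simp add: entry_sum_def sum_distrib_right)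
  finally show ?thesis .
qed

lemma transition_matrix_pow_nonneg:
  assumes "transition_matrix N A" "i < N" "j < N"
  shows "(A ^\<^sub>m k) $$ (i, j) \<ge> 0"
  using assms(3)
proof (induction k arbitrary: j)
  case 0
  then show ?case using assms by (auto simp: transition_matrix_def)
next
  case (Suc k)
  have "A ^\<^sub>m k \<in> carrier_mat N N" "A \<in> carrier_mat N N"
    using assms by (auto simp: transition_matrix_def)
  moreover have "A $$ (l, j) \<ge> 0" if "l < N" for l
  proof -
    have "A $$ (l, j) \<in> {0, 1}"
      using assms(1) that Suc.prems by (simp add: transition_matrix_def)
    then show ?thesis by auto
  qed
  ultimately show ?case
    using Suc assms(2) by (auto simp: scalar_prod_def intro!: sum_nonneg mult_nonneg_nonneg)
qed

text \<open>Right multiplication by \<open>A\<close> weights each entry of the row by a row sum of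
  \<open>A\<close>, which is at least 1, so the row sums of the powers never decrease.\<close>

lemma transition_matrix_pow_row_sum_ge_1:
  assumes "transition_matrix N A" "i < N"
  shows "(\<Sum>j<N. (A ^\<^sub>m k) $$ (i, j)) \<ge> 1"
proof (induction k)
  case 0
  then show ?case using assms by (auto simp: transition_matrix_def)
next
  case (Suc k)
  have A: "A ^\<^sub>m k \<in> carrier_mat N N" "A \<in> carrier_mat N N"
    using assms by (auto simp: transition_matrix_def)
  have "(\<Sum>l<N. (A ^\<^sub>m k) $$ (i, l) * 1) \<le> (\<Sum>l<N. (A ^\<^sub>m k) $$ (i, l) * (\<Sum>j<N. A $$ (l, j)))"
    using assms transition_matrix_pow_nonneg[OF assms]
    by (intro sum_mono mult_left_mono) (auto simp: transition_matrix_def)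
  also have "\<dots> = (\<Sum>j<N. \<Sum>l<N. (A ^\<^sub>m k) $$ (i, l) * A $$ (l, j))"
    by (subst sum.swap) (simp add: sum_distrib_left)
  also have "\<dots> = (\<Sum>j<N. (A ^\<^sub>m Suc k) $$ (i, j))"
    using A assms(2) by (simp add: scalar_prod_def atLeast0LessThan)
  finally show ?case using Suc by simp
qed

text \<open>This makes the logarithms of the entry sums nonnegative, which gives the lower bound 0
  for Fekete's lemma.\<close>

lemma entry_sum_pow_ge_1:
  assumes "transition_matrix N A"
  shows "entry_sum (A ^\<^sub>m k) \<ge> 1"
proof -
  have N: "0 < N" and A: "A ^\<^sub>m k \<in> carrier_mat N N"
    using assms by (auto simp: transition_matrix_def)
  have "1 \<le> (\<Sum>j<N. (A ^\<^sub>m k) $$ (0, j))"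
    using transition_matrix_pow_row_sum_ge_1[OF assms N] .
  also have "\<dots> \<le> (\<Sum>i<N. \<Sum>j<N. (A ^\<^sub>m k) $$ (i, j))"
    using N transition_matrix_pow_nonneg[OF assms]
    by (intro member_le_sum[where f = "\<lambda>i. \<Sum>j<N. (A ^\<^sub>m k) $$ (i, j)"]) (auto intro!: sum_nonneg)
  finally show ?thesis
    using A by (simp add: entry_sum_def del: pow_mat_dim)
qed

lemma ln_entry_sum_pow_add_le:
  assumes "transition_matrix N A"
  shows "ln (entry_sum (A ^\<^sub>m (k + l))) \<le> ln (entry_sum (A ^\<^sub>m k)) + ln (entry_sum (A ^\<^sub>m l))"
proof -
  have A: "A \<in> carrier_mat N N" using assms by (simp add: transition_matrix_def)
  have "entry_sum (A ^\<^sub>m (k + l)) \<le> entry_sum (A ^\<^sub>m k) * entry_sum (A ^\<^sub>m l)"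
    unfolding pow_mat_add[OF A]
    using transition_matrix_pow_nonneg[OF assms] A by (intro entry_sum_mult_le) auto
  then show ?thesis
    using entry_sum_pow_ge_1[OF assms, of k] entry_sum_pow_ge_1[OF assms, of l]
      entry_sum_pow_ge_1[OF assms, of "k + l"]
    by (subst ln_mult_pos[symmetric]) auto
qed

text \<open>\<open>matrix_rho\<close> is a \<open>lim\<close> and is informative only once
  convergence is known; Fekete's lemma gives convergence of the logarithms, and exponentiating gives
  that of the roots.\<close>

lemma ln_entry_sum_pow_over_n_tendsto:
  assumes "transition_matrix N A"
  shows "(\<lambda>n. ln (entry_sum (A ^\<^sub>m n)) / real n) \<longlonglongrightarrow> ln (matrix_rho A)"
proof -
  let ?a = "\<lambda>n. ln (entry_sum (A ^\<^sub>m n))"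
  have "bdd_below ((\<lambda>n. ?a n / real n) ` {1..})"
    using entry_sum_pow_ge_1[OF assms] by (intro bdd_belowI2[of _ 0]) auto
  then obtain L where L: "(\<lambda>n. ?a n / real n) \<longlonglongrightarrow> L"
    using fekete[of ?a] ln_entry_sum_pow_add_le[OF assms] by blast
  have "(\<lambda>n. exp (?a n / real n)) \<longlonglongrightarrow> exp L"
    by (intro tendsto_exp L)
  \<comment> \<open>Index 0 is excluded because \<open>root 0\<close> is constantly 0, whereas the
    exponential there equals 1.\<close>
  moreover have "\<forall>\<^sub>F n in sequentially. exp (?a n / real n) = root n (entry_sum (A ^\<^sub>m n))"
    using eventually_gt_at_top[of 0]
  proof eventually_elim
    case (elim n)
    have "entry_sum (A ^\<^sub>m n) > 0" using entry_sum_pow_ge_1[OF assms, of n] by simp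
    then show ?case using elim by (simp add: root_powr_inverse powr_def)
  qed
  ultimately have "(\<lambda>n. root n (entry_sum (A ^\<^sub>m n))) \<longlonglongrightarrow> exp L"
    using tendsto_cong by fast
  then have "matrix_rho A = exp L"
    unfolding matrix_rho_def by (rule limI)
  then show ?thesis using L by simp
qed

section \<open>Admissible words and the subshift\<close>

text \<open>The index \<open>k\<close> counts transitions: the words in \<open>words N A k\<close> have \<open>k + 1\<close> letters, to match \<open>A\<^bsup>k\<^esup>\<close>.\<close>

definition words :: "nat \<Rightarrow> real mat \<Rightarrow> nat \<Rightarrow> nat list set" where
  "words N A k = {w. length w = Suc k \<and> set w \<subseteq> {..<N} \<and> (\<forall>i<k. A $$ (w ! i, w ! Suc i) = 1)}"

lemma finite_words: "finite (words N A k)"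
  by (rule finite_subset[OF _ finite_lists_length_eq[of "{..<N}" "Suc k"]]) (auto simp: words_def)

text \<open>Removing the last letter j leaves a word ending in some l with
  \<open>A $$ (l, j) = 1\<close>, so the counts follow the recursion by which right multiplication
  by \<open>A\<close> acts on column sums.\<close>

lemma card_words_last_le:
  assumes "transition_matrix N A" "j < N"
  shows "real (card {w \<in> words N A k. last w = j}) \<le> (\<Sum>i<N. (A ^\<^sub>m k) $$ (i, j))"
  using assms(2)
proof (induction k arbitrary: j)
  case 0
  have "{w \<in> words N A 0. last w = j} \<subseteq> {[j]}"
    by (auto simp: words_def length_Suc_conv)
  then have "card {w \<in> words N A 0. last w = j} \<le> card {[j]}"
    by (intro card_mono) auto
  moreover have "(\<Sum>i<N. (A ^\<^sub>m 0) $$ (i, j)) = 1"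
    using assms(1) 0 by (auto simp: transition_matrix_def)
  ultimately show ?case by simp
next
  case (Suc k)
  let ?P = "\<lambda>l. {w \<in> words N A k. last w = l}"
  have A: "A ^\<^sub>m k \<in> carrier_mat N N" "A \<in> carrier_mat N N"
    using assms by (auto simp: transition_matrix_def)
  have fin: "finite (?P l)" for l using finite_words by simp
  have "{w \<in> words N A (Suc k). last w = j}
          \<subseteq> (\<Union>l\<in>{l. l < N \<and> A $$ (l, j) = 1}. (\<lambda>w. w @ [j]) ` ?P l)"
  proof clarsimp
    fix w assume w: "w \<in> words N A (Suc k)" and j: "j = last w"
    have len: "length w = Suc (Suc k)" using w by (simp add: words_def)
    then have ne: "w \<noteq> []" "butlast w \<noteq> []" by (auto simp: length_Suc_conv)
    have eq: "butlast w @ [last w] = w" using ne by simp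
    have nth: "butlast w ! i = w ! i" if "i \<le> k" for i
      using that len by (simp add: nth_butlast)
    have lastb: "last (butlast w) = w ! k"
      using ne nth[of k] len by (simp add: last_conv_nth)
    have lastw: "last w = w ! Suc k" using ne len by (simp add: last_conv_nth)
    have "butlast w \<in> words N A k"
      using w len nth by (auto simp: words_def dest: in_set_butlastD)
    moreover have "w ! k < N" "A $$ (w ! k, last w) = 1"
      using w len lastw by (auto simp: words_def subset_iff)
    ultimately show "\<exists>l<N. A $$ (l, last w) = 1 \<and> w \<in> (\<lambda>u. u @ [last w]) ` {u \<in> words N A k. last u = l}"
      using eq lastb by (metis (mono_tags, lifting) imageI mem_Collect_eq)
  qed
  then have "card {w \<in> words N A (Suc k). last w = j}
      \<le> card (\<Union>l\<in>{l. l < N \<and> A $$ (l, j) = 1}. (\<lambda>w. w @ [j]) ` ?P l)"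
    using fin by (intro card_mono) auto
  also have "\<dots> \<le> (\<Sum>l\<in>{l. l < N \<and> A $$ (l, j) = 1}. card ((\<lambda>w. w @ [j]) ` ?P l))"
    by (rule card_UN_le) simp
  also have "\<dots> \<le> (\<Sum>l\<in>{l. l < N \<and> A $$ (l, j) = 1}. card (?P l))"
    using fin by (intro sum_mono card_image_le)
  finally have "card {w \<in> words N A (Suc k). last w = j}
      \<le> (\<Sum>l\<in>{l. l < N \<and> A $$ (l, j) = 1}. card (?P l))" .
  then have "real (card {w \<in> words N A (Suc k). last w = j})
      \<le> (\<Sum>l\<in>{l. l < N \<and> A $$ (l, j) = 1}. real (card (?P l)))"
    unfolding of_nat_sum[symmetric] of_nat_le_iff .
  \<comment> \<open>Entries are 0 or 1, so weighting by \<open>A $$ (l, j)\<close> selects exactly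
    the predecessors of j.\<close>
  also have "\<dots> = (\<Sum>l<N. real (card (?P l)) * A $$ (l, j))"
    using assms(1) Suc.prems
    by (intro sum.mono_neutral_cong_left) (auto simp: transition_matrix_def)
  also have "\<dots> \<le> (\<Sum>l<N. (\<Sum>i<N. (A ^\<^sub>m k) $$ (i, l)) * A $$ (l, j))"
    using Suc transition_matrix_pow_nonneg[OF assms(1), of _ _ 1] A
    by (intro sum_mono mult_right_mono) auto
  also have "\<dots> = (\<Sum>i<N. \<Sum>l<N. (A ^\<^sub>m k) $$ (i, l) * A $$ (l, j))"
    by (subst sum.swap) (simp add: sum_distrib_right)
  also have "\<dots> = (\<Sum>i<N. (A ^\<^sub>m Suc k) $$ (i, j))"
    using A Suc.prems by (simp add: scalar_prod_def atLeast0LessThan)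
  finally show ?case .
qed

lemma card_words_le:
  assumes "transition_matrix N A"
  shows "real (card (words N A k)) \<le> entry_sum (A ^\<^sub>m k)"
proof -
  have A: "A ^\<^sub>m k \<in> carrier_mat N N"
    using assms by (auto simp: transition_matrix_def)
  have "words N A k = (\<Union>j<N. {w \<in> words N A k. last w = j})"
  proof -
    have "last w < N" if "w \<in> words N A k" for w
    proof -
      have "w \<noteq> []" "set w \<subseteq> {..<N}" using that by (auto simp: words_def)
      then show ?thesis using last_in_set by blast
    qed
    then show ?thesis by auto
  qed
  then have "card (words N A k) \<le> (\<Sum>j<N. card {w \<in> words N A k. last w = j})"
    using card_UN_le[of "{..<N}" "\<lambda>j. {w \<in> words N A k. last w = j}"] by simp
  then have "real (card (words N A k)) \<le> (\<Sum>j<N. real (card {w \<in> words N A k. last w = j}))"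
    by (metis of_nat_le_iff of_nat_sum)
  also have "\<dots> \<le> (\<Sum>j<N. \<Sum>i<N. (A ^\<^sub>m k) $$ (i, j))"
    using card_words_last_le[OF assms] by (intro sum_mono) auto
  also have "\<dots> = entry_sum (A ^\<^sub>m k)"
    using A by (subst sum.swap) (simp add: entry_sum_def del: pow_mat_dim)
  finally show ?thesis .
qed

section \<open>The shift and the compactness of the subshift\<close>

lemma funpow_shift: "(shift ^^ j) \<alpha> i = \<alpha> (i + j)"
  by (induction j arbitrary: i) (simp_all add: shift_def)

lemma shift_in_subshift: "\<alpha> \<in> subshift N A \<Longrightarrow> shift \<alpha> \<in> subshift N A"
  by (simp add: subshift_def shift_def)

lemma funpow_shift_in_subshift: "\<alpha> \<in> subshift N A \<Longrightarrow> (shift ^^ j) \<alpha> \<in> subshift N A"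
  by (induction j) (simp_all add: shift_in_subshift)

text \<open>The column condition supplies a predecessor of the first symbol to put in front.
  Surjectivity later yields equality, not just inclusion, for the image of
  \<open>\<C> n\<close>.\<close>

lemma shift_image_subshift:
  assumes "transition_matrix N A"
  shows "shift ` subshift N A = subshift N A"
proof
  show "subshift N A \<subseteq> shift ` subshift N A"
  proof
    fix \<beta> assume \<beta>: "\<beta> \<in> subshift N A"
    then have \<beta>0: "\<beta> 0 < N" by (simp add: subshift_def)
    have "\<exists>i<N. A $$ (i, \<beta> 0) = 1"
    proof (rule ccontr)
      assume "\<not> ?thesis"
      then have "A $$ (i, \<beta> 0) = 0" if "i < N" for i
        using assms \<beta>0 that unfolding transition_matrix_def by blast
      then have "(\<Sum>i<N. A $$ (i, \<beta> 0)) = 0" by simp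
      moreover have "(\<Sum>i<N. A $$ (i, \<beta> 0)) \<ge> 1"
        using assms \<beta>0 by (simp add: transition_matrix_def)
      ultimately show False by simp
    qed
    then obtain i where "i < N" "A $$ (i, \<beta> 0) = 1" by blast
    then have "case_nat i \<beta> \<in> subshift N A"
      using \<beta> by (auto simp: subshift_def split: nat.split)
    moreover have "shift (case_nat i \<beta>) = \<beta>" by (simp add: shift_def)
    ultimately show "\<beta> \<in> shift ` subshift N A" by (metis imageI)
  qed
qed (auto intro: shift_in_subshift)

text \<open>By the row condition every symbol has a successor; a choice of successors is iterated
  from 0.\<close>

lemma subshift_nonempty:
  assumes "transition_matrix N A"
  shows "subshift N A \<noteq> {}"
proof -
  have "\<exists>j<N. A $$ (i, j) = 1" if i: "i < N" for i
  proof (rule ccontr)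
    assume "\<not> ?thesis"
    then have "A $$ (i, j) = 0" if "j < N" for j
      using assms i that unfolding transition_matrix_def by blast
    then have "(\<Sum>j<N. A $$ (i, j)) = 0" by simp
    moreover have "(\<Sum>j<N. A $$ (i, j)) \<ge> 1"
      using assms i by (simp add: transition_matrix_def)
    ultimately show False by simp
  qed
  then obtain g where g: "\<And>i. i < N \<Longrightarrow> g i < N \<and> A $$ (i, g i) = 1" by metis
  have "(g ^^ k) 0 < N" for k
    using g assms by (induction k) (auto simp: transition_matrix_def)
  then have "(\<lambda>k. (g ^^ k) 0) \<in> subshift N A"
    using g by (simp add: subshift_def)
  then show ?thesis by blast
qed

lemma open_cylinder:
  fixes \<alpha> :: "nat \<Rightarrow> 'b::discrete_topology"
  shows "open {\<beta>. \<forall>i<M. \<beta> i = \<alpha> i}"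
proof -
  have "{\<beta>. \<forall>i<M. \<beta> i = \<alpha> i} = (\<Inter>i\<in>{..<M}. (\<lambda>\<beta>. \<beta> i) -` {\<alpha> i})" by auto
  then show ?thesis by (auto intro!: open_INT open_vimage open_discrete)
qed

text \<open>A product of finite sets is compact by Tychonoff, and the subshift is closed in it: a
  violation at place j is visible in the coordinates j and j + 1, hence persists on a cylinder of
  length j + 2.\<close>

lemma compact_subshift: "compact (subshift N A)"
proof -
  have "compactin (product_topology (\<lambda>_::nat. euclidean) UNIV) (PiE UNIV (\<lambda>_. {..<N}))"
    by (simp add: compactin_PiE finite_imp_compact)
  then have "compact (PiE UNIV (\<lambda>_::nat. {..<N}))"
    by (simp add: euclidean_product_topology)
  moreover have "closed (subshift N A)"
  proof -
    have "open (- subshift N A)"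
    proof (subst open_subopen, intro ballI)
      fix s assume "s \<in> - subshift N A"
      then obtain j where j: "\<not> (s j < N \<and> A $$ (s j, s (Suc j)) = 1)"
        by (auto simp: subshift_def)
      let ?T = "{t. \<forall>i<Suc (Suc j). t i = s i}"
      have "t \<notin> subshift N A" if "t \<in> ?T" for t
      proof
        assume "t \<in> subshift N A"
        then have "t j < N \<and> A $$ (t j, t (Suc j)) = 1" by (simp add: subshift_def)
        moreover have "t j = s j" "t (Suc j) = s (Suc j)" using that by simp_all
        ultimately show False using j by simp
      qed
      then show "\<exists>T. open T \<and> s \<in> T \<and> T \<subseteq> - subshift N A"
        using open_cylinder[of "Suc (Suc j)" s] by (intro exI[of _ ?T]) auto
    qed
    then show ?thesis by (simp add: closed_def)
  qed
  moreover have "subshift N A = PiE UNIV (\<lambda>_. {..<N}) \<inter> subshift N A"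
    by (auto simp: subshift_def)
  ultimately show ?thesis by (metis compact_Int_closed)
qed

text \<open>A disagreement at a place i \<le> M alone contributes \<open>1 / 2 ^ i\<close>, which is
  at least \<open>1 / 2 ^ M\<close>.\<close>

lemma symbol_dist_less_imp_eq:
  assumes "symbol_dist a b < 1 / 2 ^ M" "i \<le> M"
  shows "a i = b i"
proof (rule ccontr)
  assume ne: "a i \<noteq> b i"
  let ?t = "\<lambda>i. (if a i = b i then 0 else 1) / 2 ^ i :: real"
  have "summable ?t"
  proof (rule summable_comparison_test'[where g = "\<lambda>i. (1 / 2) ^ i" and N = 0])
    show "norm (?t n) \<le> (1 / 2) ^ n" for n by (simp add: power_one_over)
  qed (simp add: summable_geometric)
  then have "sum ?t {i} \<le> symbol_dist a b"
    unfolding symbol_dist_def by (intro sum_le_suminf) auto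
  moreover have "(1::real) / 2 ^ M \<le> 1 / 2 ^ i"
    using assms(2) by (simp add: divide_simps)
  ultimately show False using ne assms(1) by simp
qed

section \<open>Families of points coded by the subshift\<close>

lemma top_entropy_leI:
  assumes "\<And>\<A>. (\<And>U. U \<in> \<A> \<Longrightarrow> openin Z U) \<Longrightarrow> \<Union>\<A> = topspace Z \<Longrightarrow>
    limsup (\<lambda>n. ereal (1 / real n * ln (real (min_subcover (restrict_cover (refined_cover Z g \<A> n) Y))))) \<le> b"
  shows "top_entropy Z g Y \<le> b"
  unfolding top_entropy_def
proof (rule SUP_least)
  fix \<A> assume "\<A> \<in> {\<A>. (\<forall>U\<in>\<A>. openin Z U) \<and> \<Union>\<A> = topspace Z}"
  then have "\<And>U. U \<in> \<A> \<Longrightarrow> openin Z U" "\<Union>\<A> = topspace Z" by auto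
  then show "limsup (\<lambda>n. ereal (1 / real n *
      ln (real (min_subcover (restrict_cover (refined_cover Z g \<A> n) Y))))) \<le> b"
    by (rule assms)
qed

lemma min_subcover_le:
  assumes "\<F> \<subseteq> \<B>" "finite \<F>" "\<Union>\<F> = \<Union>\<B>"
  shows "min_subcover \<B> \<le> card \<F>"
  unfolding min_subcover_def using assms by (intro Least_le) blast

section \<open>Singletons in the hyperspace\<close>

lemma singleton_in_hyperspace [simp]: "{x} \<in> hyperspace X \<longleftrightarrow> x \<in> X"
  by (simp add: hyperspace_def)

lemma hausdorff_dist_singletons [simp]: "hausdorff_dist {x} {y} = dist x y"
  by (simp add: hausdorff_dist_def dist_commute)

text \<open>Since x \<mapsto> {x} is an isometry, this is the Lebesgue number lemma on
  \<open>X\<close> for the pulled-back cover.\<close>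

lemma hyperspace_cover_singletons:
  assumes "compact X" and op: "\<And>U. U \<in> \<A> \<Longrightarrow> openin (hyperspace_topology X) U"
    and cover: "\<Union>\<A> = topspace (hyperspace_topology X)"
  obtains \<epsilon> where "\<epsilon> > 0" "\<And>x. x \<in> X \<Longrightarrow> \<exists>U\<in>\<A>. \<forall>y\<in>X. dist x y < \<epsilon> \<longrightarrow> {y} \<in> U"
proof -
  interpret H: Metric_space "hyperspace X" hausdorff_dist
    by (rule Metric_space_hyperspace)
  \<comment> \<open>Members of \<open>?G\<close> are open in the ambient type, which may be larger
    than \<open>X\<close>; hence the condition is imposed on \<open>G \<inter> X\<close>
    only.\<close>
  let ?G = "{G. open G \<and> (\<exists>U\<in>\<A>. \<forall>y\<in>G \<inter> X. {y} \<in> U)}"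
  have "\<exists>G\<in>?G. x \<in> G" if x: "x \<in> X" for x
  proof -
    have "{x} \<in> \<Union>\<A>"
      unfolding cover using x by (simp add: hyperspace_topology_def)
    then obtain U where U: "U \<in> \<A>" "{x} \<in> U" by blast
    have "openin H.mtopology U"
      using op[OF U(1)] by (simp add: hyperspace_topology_def)
    then obtain r where r: "r > 0" "H.mball {x} r \<subseteq> U"
      unfolding H.openin_mtopology using U(2) by blast
    then have "{y} \<in> U" if "y \<in> ball x r \<inter> X" for y
      using that x by auto
    then have "ball x r \<in> ?G"
      using U by blast
    then show ?thesis using r(1) by (meson centre_in_ball)
  qed
  then have "X \<subseteq> \<Union>?G" by (meson UnionI subsetI)
  then obtain \<epsilon> where \<epsilon>: "\<epsilon> > 0" "\<And>x. x \<in> X \<Longrightarrow> \<exists>G\<in>?G. ball x \<epsilon> \<subseteq> G"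
    by (rule Heine_Borel_lemma[OF \<open>compact X\<close>]) auto
  have "\<exists>U\<in>\<A>. \<forall>y\<in>X. dist x y < \<epsilon> \<longrightarrow> {y} \<in> U" if x: "x \<in> X" for x
  proof -
    obtain G where "G \<in> ?G" "ball x \<epsilon> \<subseteq> G"
      using \<epsilon>(2)[OF x] by (rule bexE)
    then obtain U where "ball x \<epsilon> \<subseteq> G" "U \<in> \<A>" "\<forall>y\<in>G \<inter> X. {y} \<in> U" by auto
    then show ?thesis by (intro bexI[of _ U]) auto
  qed
  with \<epsilon>(1) show ?thesis by (rule that)
qed

text \<open>Equi-continuity of the maps \<open>x n\<close> in terms of common initial symbols, with
  \<open>M\<close> chosen before \<open>n\<close>. This form serves the product topology,
  \<open>symbol_dist\<close> and the counting of words alike.\<close>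

definition uniform_coding :: "nat \<Rightarrow> real mat \<Rightarrow> (nat \<Rightarrow> (nat \<Rightarrow> nat) \<Rightarrow> 'a::metric_space) \<Rightarrow> bool" where
  "uniform_coding N A x \<longleftrightarrow>
     (\<forall>\<epsilon>>0. \<exists>M. \<forall>n. \<forall>\<alpha>\<in>subshift N A. \<forall>\<beta>\<in>subshift N A.
        (\<forall>i<M. \<beta> i = \<alpha> i) \<longrightarrow> dist (x n \<alpha>) (x n \<beta>) < \<epsilon>)"

lemma uniform_codingD:
  assumes "uniform_coding N A x" "\<epsilon> > 0"
  obtains M where "\<And>n \<alpha> \<beta>. \<alpha> \<in> subshift N A \<Longrightarrow> \<beta> \<in> subshift N A \<Longrightarrow> (\<And>i. i < M \<Longrightarrow> \<beta> i = \<alpha> i) \<Longrightarrow>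
    dist (x n \<alpha>) (x n \<beta>) < \<epsilon>"
proof -
  from assms obtain M where "\<forall>n. \<forall>\<alpha>\<in>subshift N A. \<forall>\<beta>\<in>subshift N A.
      (\<forall>i<M. \<beta> i = \<alpha> i) \<longrightarrow> dist (x n \<alpha>) (x n \<beta>) < \<epsilon>"
    unfolding uniform_coding_def by blast
  then show ?thesis by (intro that) blast
qed

text \<open>Sequences with the same first n + M + 1 symbols still share M symbols after j < n
  shifts, so their points are \<epsilon>-close at all times j < n and one choice of cover elements
  serves them all.\<close>

lemma min_subcover_singletons_le:
  assumes maps: "\<And>n \<alpha>. \<alpha> \<in> subshift N A \<Longrightarrow> x n \<alpha> \<in> X"
    and conj: "\<And>n \<alpha>. \<alpha> \<in> subshift N A \<Longrightarrow> f n (x n \<alpha>) = x (Suc n) (shift \<alpha>)"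
    and \<epsilon>: "\<And>x. x \<in> X \<Longrightarrow> \<exists>U\<in>\<A>. \<forall>y\<in>X. dist x y < \<epsilon> \<longrightarrow> {y} \<in> U"
    and M: "\<And>n \<alpha> \<beta>. \<alpha> \<in> subshift N A \<Longrightarrow> \<beta> \<in> subshift N A \<Longrightarrow> (\<And>i. i < M \<Longrightarrow> \<beta> i = \<alpha> i) \<Longrightarrow>
      dist (x n \<alpha>) (x n \<beta>) < \<epsilon>"
  shows "min_subcover (restrict_cover (refined_cover (hyperspace_topology X) (induced_map f) \<A> n)
            ((\<lambda>\<alpha>. {x 0 \<alpha>}) ` subshift N A)) \<le> card (words N A (n + M))"
proof -
  interpret H: Metric_space "hyperspace X" hausdorff_dist
    by (rule Metric_space_hyperspace)
  let ?\<Sigma> = "subshift N A"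
  let ?w = "\<lambda>\<alpha>. map \<alpha> [0..<Suc (n + M)]"
  let ?C = "(\<lambda>\<alpha>. {x 0 \<alpha>}) ` ?\<Sigma>"
  obtain U where U: "\<And>x. x \<in> X \<Longrightarrow> U x \<in> \<A>" "\<And>x y. x \<in> X \<Longrightarrow> y \<in> X \<Longrightarrow> dist x y < \<epsilon> \<Longrightarrow> {y} \<in> U x"
    using \<epsilon> by metis
  \<comment> \<open>\<open>r\<close> picks a representative sequence for each occurring word; the
    cover elements in \<open>B w\<close> are those chosen around its orbit.\<close>
  define r where "r = inv_into ?\<Sigma> ?w"
  have r: "\<And>w. w \<in> ?w ` ?\<Sigma> \<Longrightarrow> r w \<in> ?\<Sigma>" "\<And>w. w \<in> ?w ` ?\<Sigma> \<Longrightarrow> ?w (r w) = w"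
    unfolding r_def by (fact inv_into_into, fact f_inv_into_f)
  have iter_x: "iter (induced_map f) 0 j {x 0 \<alpha>} = {x j ((shift ^^ j) \<alpha>)}" if "\<alpha> \<in> ?\<Sigma>" for j \<alpha>
    using that by (induction j) (simp_all add: induced_map_def conj funpow_shift_in_subshift)
  define B where "B w = {z \<in> hyperspace X. \<forall>j<n. iter (induced_map f) 0 j z \<in> U (x j ((shift ^^ j) (r w)))}" for w
  have in_B: "{x 0 \<alpha>} \<in> B (?w \<alpha>)" if \<alpha>: "\<alpha> \<in> ?\<Sigma>" for \<alpha>
  proof -
    let ?\<beta> = "r (?w \<alpha>)"
    have \<beta>: "?\<beta> \<in> ?\<Sigma>" "?w ?\<beta> = ?w \<alpha>" using r[OF imageI[OF \<alpha>]] by simp_all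
    have "{x j ((shift ^^ j) \<alpha>)} \<in> U (x j ((shift ^^ j) ?\<beta>))" if "j < n" for j
    proof (intro U maps M funpow_shift_in_subshift \<beta>(1) \<alpha>)
      fix i assume "i < M"
      then have "i + j < Suc (n + M)" using that by simp
      then have "\<alpha> (i + j) = ?\<beta> (i + j)"
        using \<beta>(2) unfolding map_eq_conv by (metis atLeastLessThan_iff le0 set_upt)
      then show "(shift ^^ j) \<alpha> i = (shift ^^ j) ?\<beta> i"
        by (simp only: funpow_shift)
    qed
    then show ?thesis
      unfolding B_def using \<alpha> maps by (simp add: iter_x)
  qed
  let ?R = "restrict_cover (refined_cover (hyperspace_topology X) (induced_map f) \<A> n) ?C"
  let ?F = "(\<lambda>w. B w \<inter> ?C) ` ?w ` ?\<Sigma>"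
  have ws: "?w ` ?\<Sigma> \<subseteq> words N A (n + M)"
    by (auto simp: words_def subshift_def simp del: upt_Suc)
  then have fin: "finite (?w ` ?\<Sigma>)" using finite_words finite_subset by blast
  have "B w \<in> refined_cover (hyperspace_topology X) (induced_map f) \<A> n" if "w \<in> ?w ` ?\<Sigma>" for w
    unfolding refined_cover_def B_def hyperspace_topology_def H.topspace_mtopology
    using U(1) maps funpow_shift_in_subshift r(1)[OF that]
    by (intro CollectI exI[of _ "\<lambda>j. U (x j ((shift ^^ j) (r w)))"]) auto
  then have sub: "?F \<subseteq> ?R"
    unfolding restrict_cover_def by blast
  \<comment> \<open>Both unions equal \<open>?C\<close>: restricted sets lie in it, and the members
    of \<open>?F\<close>, which belong to \<open>?R\<close>, already cover it.\<close>
  have "\<Union>?R \<subseteq> ?C" by (auto simp: restrict_cover_def)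
  also have "?C \<subseteq> \<Union>?F" using in_B by blast
  finally have "\<Union>?F = \<Union>?R"
    using Union_mono[OF sub] by (intro equalityI)
  then have "min_subcover ?R \<le> card ?F"
    using sub fin by (intro min_subcover_le) auto
  also have "\<dots> \<le> card (?w ` ?\<Sigma>)" using fin by (rule card_image_le)
  also have "\<dots> \<le> card (words N A (n + M))" using ws finite_words by (rule card_mono[rotated])
  finally show ?thesis .
qed

text \<open>By submultiplicativity the M extra symbols cost only the factor
  \<open>entry_sum (A ^\<^sub>m M)\<close>, whose logarithm divided by n tends to 0.\<close>

lemma top_entropy_singletons_le:
  assumes "compact X" and A: "transition_matrix N A"
    and "\<And>n \<alpha>. \<alpha> \<in> subshift N A \<Longrightarrow> x n \<alpha> \<in> X"
    and "\<And>n \<alpha>. \<alpha> \<in> subshift N A \<Longrightarrow> f n (x n \<alpha>) = x (Suc n) (shift \<alpha>)"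
    and unif: "uniform_coding N A x"
  shows "top_entropy (hyperspace_topology X) (induced_map f) ((\<lambda>\<alpha>. {x 0 \<alpha>}) ` subshift N A)
           \<le> ereal (ln (matrix_rho A))"
proof (rule top_entropy_leI)
  fix \<A> assume op: "\<And>U. U \<in> \<A> \<Longrightarrow> openin (hyperspace_topology X) U"
    and cover: "\<Union>\<A> = topspace (hyperspace_topology X)"
  let ?c = "\<lambda>n. min_subcover (restrict_cover (refined_cover (hyperspace_topology X) (induced_map f) \<A> n)
            ((\<lambda>\<alpha>. {x 0 \<alpha>}) ` subshift N A))"
  let ?a = "\<lambda>n. ln (entry_sum (A ^\<^sub>m n))"
  obtain \<epsilon> where \<epsilon>: "\<epsilon> > 0" "\<And>x. x \<in> X \<Longrightarrow> \<exists>U\<in>\<A>. \<forall>y\<in>X. dist x y < \<epsilon> \<longrightarrow> {y} \<in> U"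
    using hyperspace_cover_singletons[OF \<open>compact X\<close> op cover] by blast
  obtain M where M: "\<And>n \<alpha> \<beta>. \<alpha> \<in> subshift N A \<Longrightarrow> \<beta> \<in> subshift N A \<Longrightarrow> (\<And>i. i < M \<Longrightarrow> \<beta> i = \<alpha> i) \<Longrightarrow>
      dist (x n \<alpha>) (x n \<beta>) < \<epsilon>"
    using uniform_codingD[OF unif \<epsilon>(1)] by blast
  have "1 / real n * ln (real (?c n)) \<le> ?a n / real n + ?a M / real n" for n
  proof -
    have "?c n \<le> card (words N A (n + M))"
      using assms(3,4) \<epsilon>(2) M by (rule min_subcover_singletons_le)
    then have "real (?c n) \<le> entry_sum (A ^\<^sub>m (n + M))"
      using card_words_le[OF A, of "n + M"] by linarith
    \<comment> \<open>For a zero count this rests on \<open>ln 0 = 0\<close> and the nonnegativity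
      of \<open>?a\<close>.\<close>
    then have "ln (real (?c n)) \<le> ?a (n + M)"
      using entry_sum_pow_ge_1[OF A, of "n + M"] by (cases "?c n = 0") auto
    also have "\<dots> \<le> ?a n + ?a M"
      by (rule ln_entry_sum_pow_add_le[OF A])
    finally have "ln (real (?c n)) / real n \<le> (?a n + ?a M) / real n"
      by (rule divide_right_mono) simp
    then show ?thesis by (simp add: add_divide_distrib)
  qed
  then have "limsup (\<lambda>n. ereal (1 / real n * ln (real (?c n))))
      \<le> limsup (\<lambda>n. ereal (?a n / real n + ?a M / real n))"
    by (intro Limsup_mono) simp
  also have "\<dots> = ereal (ln (matrix_rho A) + 0)"
    by (rule lim_imp_Limsup[OF sequentially_bot tendsto_ereal])
       (rule tendsto_add[OF ln_entry_sum_pow_over_n_tendsto[OF A] lim_const_over_n])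
  finally show "limsup (\<lambda>n. ereal (1 / real n * ln (real (?c n)))) \<le> ereal (ln (matrix_rho A))"
    by simp
qed

text \<open>The family is a continuous image of the compact subshift: a cylinder of length M is an
  open neighbourhood sent into an \<epsilon>-ball.\<close>

lemma compactin_singletons:
  assumes maps: "\<And>\<alpha>. \<alpha> \<in> subshift N A \<Longrightarrow> x n \<alpha> \<in> X" and unif: "uniform_coding N A x"
  shows "compactin (hyperspace_topology X) ((\<lambda>\<alpha>. {x n \<alpha>}) ` subshift N A)"
proof (rule image_compactin)
  interpret H: Metric_space "hyperspace X" hausdorff_dist
    by (rule Metric_space_hyperspace)
  show "compactin (top_of_set (subshift N A)) (subshift N A)"
    using compact_subshift by simp
  show "continuous_map (top_of_set (subshift N A)) (hyperspace_topology X) (\<lambda>\<alpha>. {x n \<alpha>})"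
    unfolding hyperspace_topology_def H.continuous_map_to_metric
  proof (intro ballI allI impI)
    fix \<alpha> and \<epsilon> :: real
    assume "\<alpha> \<in> topspace (top_of_set (subshift N A))" and "\<epsilon> > 0"
    then have \<alpha>: "\<alpha> \<in> subshift N A" by simp
    obtain M where M: "\<And>n \<alpha> \<beta>. \<alpha> \<in> subshift N A \<Longrightarrow> \<beta> \<in> subshift N A \<Longrightarrow> (\<And>i. i < M \<Longrightarrow> \<beta> i = \<alpha> i) \<Longrightarrow>
        dist (x n \<alpha>) (x n \<beta>) < \<epsilon>"
      using uniform_codingD[OF unif \<open>\<epsilon> > 0\<close>] by blast
    let ?U = "subshift N A \<inter> {\<beta>. \<forall>i<M. \<beta> i = \<alpha> i}"
    have "openin (top_of_set (subshift N A)) ?U"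
      by (intro openin_open_Int open_cylinder)
    moreover have "\<forall>\<beta>\<in>?U. {x n \<beta>} \<in> H.mball {x n \<alpha>} \<epsilon>"
      using \<alpha> maps M by simp
    ultimately show "\<exists>U. openin (top_of_set (subshift N A)) U \<and> \<alpha> \<in> U \<and> (\<forall>\<beta>\<in>U. {x n \<beta>} \<in> H.mball {x n \<alpha>} \<epsilon>)"
      using \<alpha> by blast
  qed
qed

lemma equi_semiconjugate_singletons:
  assumes conj: "\<And>n \<alpha>. \<alpha> \<in> subshift N A \<Longrightarrow> f n (x n \<alpha>) = x (Suc n) (shift \<alpha>)"
    and unif: "uniform_coding N A x"
  shows "equi_semiconjugate (subshift N A) symbol_dist shift
           (\<lambda>n. (\<lambda>\<alpha>. {x n \<alpha>}) ` subshift N A) hausdorff_dist (induced_map f)"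
  unfolding equi_semiconjugate_def
proof (intro exI[of _ "\<lambda>n \<alpha>. {x n \<alpha>}"] conjI allI ballI impI)
  fix \<epsilon> :: real assume "\<epsilon> > 0"
  then obtain M where M: "\<And>n \<alpha> \<beta>. \<alpha> \<in> subshift N A \<Longrightarrow> \<beta> \<in> subshift N A \<Longrightarrow> (\<And>i. i < M \<Longrightarrow> \<beta> i = \<alpha> i) \<Longrightarrow>
      dist (x n \<alpha>) (x n \<beta>) < \<epsilon>"
    using uniform_codingD[OF unif] by blast
  \<comment> \<open>Distance below \<open>1 / 2 ^ M\<close> forces agreement up to place M; since
    \<open>M\<close> does not depend on n, neither does this \<delta>.\<close>
  have "dist (x n \<alpha>) (x n \<beta>) < \<epsilon>"
    if "\<alpha> \<in> subshift N A" "\<beta> \<in> subshift N A" "symbol_dist \<alpha> \<beta> < 1 / 2 ^ M" for n \<alpha> \<beta>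
    using that symbol_dist_less_imp_eq[OF that(3)] by (intro M) auto
  then show "\<exists>\<delta>>0. \<forall>n. \<forall>\<alpha>\<in>subshift N A. \<forall>\<beta>\<in>subshift N A.
      symbol_dist \<alpha> \<beta> < \<delta> \<longrightarrow> hausdorff_dist {x n \<alpha>} {x n \<beta>} < \<epsilon>"
    by (intro exI[of _ "1 / 2 ^ M"]) auto
qed (auto simp: induced_map_def conj)

section \<open>Points with a prescribed itinerary\<close>

text \<open>The recursion of \<open>iter\<close> adds the map applied last; shifting an itinerary
  requires splitting off the first one.\<close>

lemma iter_Suc_shift: "iter f i (Suc k) x = iter f (Suc i) k (f i x)"
  by (induction k) simp_all

lemma iter_mapsto:
  assumes "\<And>n. f n ` X \<subseteq> X" "x \<in> X"
  shows "iter f n k x \<in> X"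
  using assms by (induction k) auto

lemma continuous_on_iter:
  assumes "\<And>n. f n ` X \<subseteq> X" "\<And>n. continuous_on X (f n)"
  shows "continuous_on X (iter f n k)"
proof (induction k)
  case (Suc k)
  have "iter f n k ` X \<subseteq> X" using iter_mapsto[of f, OF assms(1)] by (rule image_subsetI)
  then have "continuous_on X (f (n + k) \<circ> iter f n k)"
    using Suc assms(2) by (intro continuous_on_compose) (auto intro: continuous_on_subset)
  then show ?case by simp
qed (simp add: continuous_on_id)

lemma itinerary_set_antimono: "m \<le> m' \<Longrightarrow> itinerary_set X f V \<alpha> m' n \<subseteq> itinerary_set X f V \<alpha> m n"
  unfolding itinerary_set_def by (rule INF_superset_mono) auto

lemma itinerary_set_subset: "itinerary_set X f V \<alpha> m n \<subseteq> X"
  by (auto simp: itinerary_set_def)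

lemma closed_itinerary_set:
  assumes "closed X" "\<And>n. f n ` X \<subseteq> X" "\<And>n. continuous_on X (f n)"
    and "\<And>k. closed (V (\<alpha> k) (n + k))"
  shows "closed (itinerary_set X f V \<alpha> m n)"
proof -
  have "{x \<in> X. iter f n k x \<in> V (\<alpha> k) (n + k)} = X \<inter> iter f n k -` V (\<alpha> k) (n + k)" for k
    by auto
  then show ?thesis
    unfolding itinerary_set_def
    using assms by (intro closed_INT ballI) (simp add: continuous_closed_preimage continuous_on_iter)
qed

text \<open>The constraints k = 1, ..., m + 1 on x become the constraints 0, ..., m on
  \<open>f n x\<close>, so one level of depth is lost.\<close>

lemma f_in_itinerary_set_shift:
  assumes "\<And>n. f n ` X \<subseteq> X" "x \<in> itinerary_set X f V \<alpha> (Suc m) n"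
  shows "f n x \<in> itinerary_set X f V (shift \<alpha>) m (Suc n)"
proof -
  have x: "x \<in> X" "\<And>k. k \<le> Suc m \<Longrightarrow> iter f n k x \<in> V (\<alpha> k) (n + k)"
    using assms(2) by (auto simp: itinerary_set_def)
  then show ?thesis
    using assms(1) x(2)[of "Suc _"] unfolding itinerary_set_def
    by (auto simp: shift_def iter_Suc_shift simp del: iter.simps)
qed

text \<open>Cantor's intersection theorem: compactness gives a common point, and two common points
  are no further apart than diameters tending to 0.\<close>

lemma Inter_closed_diameter_tendsto_0_eq_singleton:
  fixes F :: "nat \<Rightarrow> 'a::metric_space set"
  assumes "compact X" and sub: "\<And>m. F m \<subseteq> X" and cl: "\<And>m. closed (F m)" and ne: "\<And>m. F m \<noteq> {}"
    and anti: "\<And>m m'. m \<le> m' \<Longrightarrow> F m' \<subseteq> F m"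
    and diam: "(\<lambda>m. diameter (F m)) \<longlonglongrightarrow> 0"
  shows "\<exists>x. (\<Inter>m. F m) = {x}"
proof -
  have "X \<inter> (\<Inter>m\<in>UNIV. F m) \<noteq> {}"
  proof (rule compact_imp_fip_image[OF \<open>compact X\<close> cl])
    fix I :: "nat set" assume "finite I"
    then obtain m where "\<And>i. i \<in> I \<Longrightarrow> i \<le> m" by (meson finite_nat_set_iff_bounded_le)
    then have "F m \<subseteq> X \<inter> (\<Inter>i\<in>I. F i)" by (intro Int_greatest INT_greatest anti sub)
    then show "X \<inter> (\<Inter>i\<in>I. F i) \<noteq> {}" using ne[of m] by (auto simp only: subset_empty)
  qed
  then obtain x where x: "\<And>m. x \<in> F m" by blast
  have "y = x" if "y \<in> (\<Inter>m. F m)" for y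
  proof -
    have y: "y \<in> F m" for m using that by blast
    have "dist y x \<le> diameter (F m)" for m
      using bounded_subset[OF compact_imp_bounded[OF \<open>compact X\<close>] sub] y x
      by (rule diameter_bounded_bound)
    then have "dist y x \<le> 0" by (intro LIMSEQ_le_const[OF diam]) auto
    then show ?thesis by simp
  qed
  then show ?thesis using x by blast
qed

text \<open>Each code has a depth at which the diameters are below \<epsilon> for all n. Finitely
  many of the corresponding cylinders cover the subshift, and a bound on their lengths serves as
  M.\<close>

lemma uniform_coding_itinerary_points:
  assumes "bounded X"
    and x: "\<And>m n \<alpha>. \<alpha> \<in> subshift N A \<Longrightarrow> x n \<alpha> \<in> itinerary_set X f V \<alpha> m n"
    and diam: "\<And>\<alpha>. \<alpha> \<in> subshift N A \<Longrightarrow>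
           uniform_limit UNIV (\<lambda>m n. diameter (itinerary_set X f V \<alpha> m n)) (\<lambda>_. 0) sequentially"
  shows "uniform_coding N A x"
  unfolding uniform_coding_def
proof (intro allI impI)
  let ?\<Sigma> = "subshift N A"
  fix \<epsilon> :: real assume "\<epsilon> > 0"
  have "\<exists>m. \<forall>n. diameter (itinerary_set X f V \<alpha> m n) < \<epsilon>" if "\<alpha> \<in> ?\<Sigma>" for \<alpha>
  proof -
    have "\<forall>\<^sub>F m in sequentially. \<forall>n. dist (diameter (itinerary_set X f V \<alpha> m n)) 0 < \<epsilon>"
      using uniform_limitD[OF diam[OF that] \<open>\<epsilon> > 0\<close>] by simp
    then show ?thesis
      unfolding eventually_sequentially by (auto simp: dist_real_def abs_less_iff)
  qed
  then obtain m where m: "\<And>\<alpha> n. \<alpha> \<in> ?\<Sigma> \<Longrightarrow> diameter (itinerary_set X f V \<alpha> (m \<alpha>) n) < \<epsilon>"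
    by metis
  \<comment> \<open>Depth \<open>m \<alpha>\<close> involves the symbols 0 to
    \<open>m \<alpha>\<close>, hence cylinders of length \<open>Suc (m \<alpha>)\<close>.\<close>
  have "?\<Sigma> \<subseteq> (\<Union>\<alpha>\<in>?\<Sigma>. {\<beta>. \<forall>i<Suc (m \<alpha>). \<beta> i = \<alpha> i})" by blast
  then obtain D where D: "D \<subseteq> ?\<Sigma>" "finite D" "?\<Sigma> \<subseteq> (\<Union>\<alpha>\<in>D. {\<beta>. \<forall>i<Suc (m \<alpha>). \<beta> i = \<alpha> i})"
    by (rule compactE_image[OF compact_subshift open_cylinder])
  obtain M where M: "\<And>\<alpha>. \<alpha> \<in> D \<Longrightarrow> Suc (m \<alpha>) \<le> M"
    using finite_nat_set_iff_bounded_le[of "(\<lambda>\<alpha>. Suc (m \<alpha>)) ` D"] D(2) by auto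
  have "dist (x n \<alpha>) (x n \<beta>) < \<epsilon>"
    if \<alpha>: "\<alpha> \<in> ?\<Sigma>" and \<beta>: "\<beta> \<in> ?\<Sigma>" and eq: "\<forall>i<M. \<beta> i = \<alpha> i" for n \<alpha> \<beta>
  proof -
    obtain \<gamma> where \<gamma>: "\<gamma> \<in> D" "\<forall>i<Suc (m \<gamma>). \<alpha> i = \<gamma> i"
      using D(3) \<alpha> by blast
    let ?V = "itinerary_set X f V \<gamma> (m \<gamma>) n"
    \<comment> \<open>Both sequences agree with \<gamma> on every symbol this depth sees: \<alpha>
      by the choice of \<gamma>, and \<beta> because it shares at least that many symbols with
      \<alpha>.\<close>
    have "itinerary_set X f V \<alpha> (m \<gamma>) n = ?V" "itinerary_set X f V \<beta> (m \<gamma>) n = ?V"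
      using \<gamma> eq M[OF \<gamma>(1)] by (auto simp: itinerary_set_def)
    then have "x n \<alpha> \<in> ?V" "x n \<beta> \<in> ?V"
      using x[OF \<alpha>] x[OF \<beta>] by blast+
    moreover have "bounded ?V"
      using bounded_subset[OF \<open>bounded X\<close> itinerary_set_subset] .
    ultimately have "dist (x n \<alpha>) (x n \<beta>) \<le> diameter ?V"
      by (intro diameter_bounded_bound)
    also have "\<dots> < \<epsilon>" using m \<gamma>(1) D(1) by blast
    finally show ?thesis .
  qed
  then show "\<exists>M. \<forall>n. \<forall>\<alpha>\<in>?\<Sigma>. \<forall>\<beta>\<in>?\<Sigma>. (\<forall>i<M. \<beta> i = \<alpha> i) \<longrightarrow> dist (x n \<alpha>) (x n \<beta>) < \<epsilon>"
    by blast
qed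

theorem theorem4p6:
  fixes X :: "'a::metric_space set"
    and f :: "nat \<Rightarrow> 'a \<Rightarrow> 'a"
    and N :: nat
    and A :: "real mat"
    and V :: "nat \<Rightarrow> nat \<Rightarrow> 'a set"
  assumes "compact X"
    and "\<And>n. f n ` X \<subseteq> X"
    and "\<And>n. continuous_on X (f n)"
    and "transition_matrix N A"
    and "\<And>i n. i < N \<Longrightarrow> V i n \<noteq> {}"
    and "\<And>i n. i < N \<Longrightarrow> closedin (top_of_set X) (V i n)"
    and "\<And>m n \<alpha>. \<alpha> \<in> subshift N A \<Longrightarrow> itinerary_set X f V \<alpha> m n \<noteq> {}"
    and "\<And>\<alpha>. \<alpha> \<in> subshift N A \<Longrightarrow>
           uniform_limit UNIV (\<lambda>m n. diameter (itinerary_set X f V \<alpha> m n)) (\<lambda>_. 0) sequentially"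
  shows "\<exists>\<C> :: nat \<Rightarrow> 'a set set.
           (\<forall>n. \<C> n \<noteq> {} \<and> compactin (hyperspace_topology X) (\<C> n) \<and>
                \<C> n \<subseteq> (\<Union>i<N. hyper_sub X (V i n)) \<and>
                induced_map f n ` \<C> n = \<C> (Suc n)) \<and>
           equi_semiconjugate (subshift N A) symbol_dist shift \<C> hausdorff_dist (induced_map f) \<and>
           top_entropy (hyperspace_topology X) (induced_map f) (\<C> 0) \<le> ereal (ln (matrix_rho A))"
proof -
  let ?\<Sigma> = "subshift N A"
  let ?I = "itinerary_set X f V"
  have closed: "closed (?I \<alpha> m n)" if "\<alpha> \<in> ?\<Sigma>" for \<alpha> m n
  proof (rule closed_itinerary_set[OF _ assms(2,3)])
    show "closed X" using \<open>compact X\<close> by (rule compact_imp_closed)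
    show "closed (V (\<alpha> k) (n + k))" for k
      using assms(6) that closedin_closed_trans[OF _ \<open>closed X\<close>] by (simp add: subshift_def)
  qed
  have "\<exists>y. (\<Inter>m. ?I \<alpha> m n) = {y}" if "\<alpha> \<in> ?\<Sigma>" for \<alpha> n
    using tendsto_uniform_limitI[OF assms(8)[OF that], of n]
    by (intro Inter_closed_diameter_tendsto_0_eq_singleton[OF \<open>compact X\<close> itinerary_set_subset]
        closed assms(7) that itinerary_set_antimono) auto
  then have "\<forall>n. \<forall>\<alpha>\<in>?\<Sigma>. \<exists>y. (\<Inter>m. ?I \<alpha> m n) = {y}" by blast
  then obtain x where "\<forall>n. \<forall>\<alpha>\<in>?\<Sigma>. (\<Inter>m. ?I \<alpha> m n) = {x n \<alpha>}"
    unfolding bchoice_iff choice_iff by blast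
  then have x: "\<And>\<alpha> n. \<alpha> \<in> ?\<Sigma> \<Longrightarrow> (\<Inter>m. ?I \<alpha> m n) = {x n \<alpha>}" by blast
  have x_in: "x n \<alpha> \<in> ?I \<alpha> m n" if "\<alpha> \<in> ?\<Sigma>" for m n \<alpha>
    using x[OF that, of n] by blast
  have x_X: "x n \<alpha> \<in> X" if "\<alpha> \<in> ?\<Sigma>" for n \<alpha>
    using subsetD[OF itinerary_set_subset x_in[OF that, of n 0]] .
  have conj: "f n (x n \<alpha>) = x (Suc n) (shift \<alpha>)" if "\<alpha> \<in> ?\<Sigma>" for n \<alpha>
  proof -
    \<comment> \<open>For each m, depth m + 1 of the point gives depth m of its image; the shifted
      itinerary has only one point of all depths.\<close>
    have "f n (x n \<alpha>) \<in> (\<Inter>m. ?I (shift \<alpha>) m (Suc n))"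
      by (intro INT_I f_in_itinerary_set_shift[OF assms(2) x_in[OF that]])
    then show ?thesis using x[OF shift_in_subshift[OF that]] by simp
  qed
  have unif: "uniform_coding N A x"
    using compact_imp_bounded[OF \<open>compact X\<close>] x_in assms(8) by (rule uniform_coding_itinerary_points)
  let ?C = "\<lambda>n. (\<lambda>\<alpha>. {x n \<alpha>}) ` ?\<Sigma>"
  have "?C n \<subseteq> (\<Union>i<N. hyper_sub X (V i n))" for n
  proof
    fix B assume "B \<in> ?C n"
    then obtain \<alpha> where \<alpha>: "\<alpha> \<in> ?\<Sigma>" "B = {x n \<alpha>}" by blast
    \<comment> \<open>Depth 0 leaves only the constraint k = 0, where \<open>iter\<close> is the
      identity.\<close>
    then have "x n \<alpha> \<in> V (\<alpha> 0) n" "\<alpha> 0 < N"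
      using x_in[OF \<alpha>(1), of n 0] by (auto simp: itinerary_set_def subshift_def)
    then show "B \<in> (\<Union>i<N. hyper_sub X (V i n))"
      using \<alpha> x_X by (auto simp: hyper_sub_def)
  qed
  moreover have "induced_map f n ` ?C n = ?C (Suc n)" for n
  proof -
    have "induced_map f n ` ?C n = (\<lambda>\<alpha>. {x (Suc n) (shift \<alpha>)}) ` ?\<Sigma>"
      unfolding image_image induced_map_def using conj by (intro image_cong) auto
    also have "\<dots> = (\<lambda>\<alpha>. {x (Suc n) \<alpha>}) ` shift ` ?\<Sigma>"
      by (simp only: image_image)
    also have "\<dots> = ?C (Suc n)"
      by (simp only: shift_image_subshift[OF assms(4)])
    finally show ?thesis .
  qed
  ultimately show ?thesis
    using subshift_nonempty[OF assms(4)] compactin_singletons[OF x_X unif]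
      equi_semiconjugate_singletons[OF conj unif]
      top_entropy_singletons_le[OF \<open>compact X\<close> assms(4) x_X conj unif]
    by (intro exI[of _ ?C] conjI allI) simp_all
qed

end
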